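(* Let $H$ be a finite hypergraph with positive functions $\delta_{V(H)}:V(H)\to(0,\infty)$ and $\delta_{E(H)}:E(H)\to(0,\infty)$. Suppose that for every unit $W_E\in\mathfrak{U}(H)$ there is a constant $c_E$ with $\delta_{V(H)}(v)=c_E$ for all $v\in W_E$. Then the complete spectrum of $L_{(H,\delta_{V(H)},\delta_{E(H)})}$ is the following (eigenvalues counted with multiplicity). (1) For each unit $W_E\in\mathfrak{U}(H)$, $\sum_{e\in E}\frac{\delta_{E(H)}(e)}{c_E|e|}$ is an eigenvalue of $L_{(H,\delta_{V(H)},\delta_{E(H)})}$ with multiplicity $|W_E|-1$ (this being the contribution of the unit $W_E$ to the list), and $S_{W_E}$ is a subspace of the eigenspace of the eigenvalue $\sum_{e\in E}\frac{\delta_{E(H)}(e)}{c_E|e|}$. (2) For each eigenvalue $\lambda$ of $\hat{L}_H$ with eigenvector $y:\mathfrak{U}(H)\to\mathbb{C}$, $\lambda$ is also an eigenvalue of $L_{(H,\delta_{V(H)},\delta_{E(H)})}$ with the blow up $y_{\mathfrak{R}_s}$ as an eigenvector.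
   Context: A (finite) hypergraph $H$ is a pair $(V(H),E(H))$, where $V(H)$ is a non-empty finite set and $E(H)$ is a collection of non-empty subsets of $V(H)$. For $v\in V(H)$ the star is $E_v(H)=\{e\in E(H):v\in e\}$. $\mathbb{C}^{X}$ is the space of functions $X\to\mathbb{C}$. Units: $\mathfrak{R}_s=\{(u,v)\in V(H)\times V(H):E_u(H)=E_v(H)\}$ is an equivalence relation; its classes are called units and $\mathfrak{U}(H)$ is the set of all units. A unit is written $W_E$, where $E\subseteq E(H)$ is its generating set: $W_E=\{v\in V(H):E_v(H)=E\}$. The general Laplacian $L_{(H,\delta_{V(H)},\delta_{E(H)})}:\mathbb{C}^{V(H)}\to\mathbb{C}^{V(H)}$ is $$(L_{(H,\delta_{V(H)},\delta_{E(H)})}x)(v)=\sum_{e\in E_v(H)}\frac{\delta_{E(H)}(e)}{\delta_{V(H)}(v)}\frac{1}{|e|^2}\sum_{u\in e}(x(v)-x(u)).$$ When $\delta_{V(H)}$ equals a constant $c_E$ on each unit $W_E$, and $\mathfrak{U}(H)=\{W_{E_1},\dots,W_{E_m}\}$, $\hat{L}_H:\mathbb{C}^{\mathfrak{U}(H)}\to\mathbb{C}^{\mathfrak{U}(H)}$ is the contraction $(\hat{L}_Hy)(W_{E_j})=\sum_{i=1}^m c^i_j\,y(W_{E_i})$ with $$c^i_j=\sum_{e\in E_j}\frac{\delta_{E(H)}(e)}{c_{E_j}}\frac{1}{|e|^2}\big(\delta_{ij}|e|-|e\cap W_{E_i}|\big),$$ where $\delta_{ij}=1$ if $i=j$ and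 $0$ otherwise. For $y:\mathfrak{U}(H)\to\mathbb{C}$, the blow up $y_{\mathfrak{R}_s}:V(H)\to\mathbb{C}$ is $y_{\mathfrak{R}_s}(v)=y(W)$ where $W$ is the unit containing $v$. For $U\subseteq V(H)$, $S_U=\{x\in\mathbb{C}^{V(H)}: \{v: x(v)\neq 0\}\subseteq U,\ \sum_{v\in U}x(v)=0\}$. *)

theory Defs
  imports
    "Jordan_Normal_Form.Char_Poly"
    "HOL-Library.Function_Algebras"
    "HOL-Library.Multiset"
begin

section \<open>Linear operators on the space of complex functions on a finite set\<close>

text \<open>
  A function on a finite set \<open>X\<close> is represented by a total function that vanishes
  outside \<open>X\<close>, so that equality of functions on \<open>X\<close> is HOL equality.
\<close>

definition cfun_space :: "'a set \<Rightarrow> ('a \<Rightarrow> complex) set" where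
  "cfun_space X = {x. \<forall>v. v \<notin> X \<longrightarrow> x v = 0}"

definition cscale :: "complex \<Rightarrow> ('a \<Rightarrow> complex) \<Rightarrow> 'a \<Rightarrow> complex" where
  "cscale a x = (\<lambda>v. a * x v)"

definition op_eigenspace ::
    "'a set \<Rightarrow> (('a \<Rightarrow> complex) \<Rightarrow> 'a \<Rightarrow> complex) \<Rightarrow> complex \<Rightarrow> ('a \<Rightarrow> complex) set" where
  "op_eigenspace X T \<mu> = {x \<in> cfun_space X. T x = cscale \<mu> x}"

definition op_eigenvector ::
    "'a set \<Rightarrow> (('a \<Rightarrow> complex) \<Rightarrow> 'a \<Rightarrow> complex) \<Rightarrow> ('a \<Rightarrow> complex) \<Rightarrow> complex \<Rightarrow> bool" where
  "op_eigenvector X T x \<mu> \<longleftrightarrow> x \<in> op_eigenspace X T \<mu> \<and> x \<noteq> (\<lambda>_. 0)"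

definition op_eigenvalue ::
    "'a set \<Rightarrow> (('a \<Rightarrow> complex) \<Rightarrow> 'a \<Rightarrow> complex) \<Rightarrow> complex \<Rightarrow> bool" where
  "op_eigenvalue X T \<mu> \<longleftrightarrow> (\<exists>x. op_eigenvector X T x \<mu>)"

text \<open>
  The matrix of \<open>T\<close> in the basis of indicator functions of points, listed in the order \<open>xs\<close>.
\<close>

definition op_matrix ::
    "'a list \<Rightarrow> (('a \<Rightarrow> complex) \<Rightarrow> 'a \<Rightarrow> complex) \<Rightarrow> complex mat" where
  "op_matrix xs T =
     mat (length xs) (length xs) (\<lambda>(i, j). T (\<lambda>z. if z = xs ! j then 1 else 0) (xs ! i))"

text \<open>
  The complete spectrum, as a multiset: the roots of the characteristic polynomial, each with
  its algebraic multiplicity. Reordering the basis conjugates the matrix by a permutation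
  matrix, so the choice of the enumeration is immaterial.
\<close>

definition op_spectrum ::
    "'a set \<Rightarrow> (('a \<Rightarrow> complex) \<Rightarrow> 'a \<Rightarrow> complex) \<Rightarrow> complex multiset" where
  "op_spectrum X T = proots (char_poly (op_matrix (SOME xs. distinct xs \<and> set xs = X) T))"

section \<open>Hypergraphs and units\<close>

locale hypergraph =
  fixes V :: "'a set" and E :: "'a set set"
  assumes finite_vertices: "finite V"
    and vertices_nonempty: "V \<noteq> {}"
    and edge_subset: "e \<in> E \<Longrightarrow> e \<subseteq> V"
    and edge_nonempty: "e \<in> E \<Longrightarrow> e \<noteq> {}"

definition star :: "'a set set \<Rightarrow> 'a \<Rightarrow> 'a set set" where
  "star E v = {e \<in> E. v \<in> e}"

definition unit_rel :: "'a set \<Rightarrow> 'a set set \<Rightarrow> ('a \<times> 'a) set" where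
  "unit_rel V E = {(u, v) \<in> V \<times> V. star E u = star E v}"

definition units :: "'a set \<Rightarrow> 'a set set \<Rightarrow> 'a set set" where
  "units V E = V // unit_rel V E"

text \<open>
  The set \<open>F\<close> of edges such that the given unit \<open>W\<close> is \<open>W\<^sub>F\<close>; the lemma below shows that it
  is well defined.
\<close>

definition generating_set :: "'a set \<Rightarrow> 'a set set \<Rightarrow> 'a set \<Rightarrow> 'a set set" where
  "generating_set V E W = (THE F. W = {v \<in> V. star E v = F})"

lemma generating_set_star:
  assumes "W \<in> units V E" "v \<in> W"
  shows "generating_set V E W = star E v"
proof -
  have "W = {u \<in> V. star E u = star E v}" and "v \<in> V"
    using assms by (auto simp: units_def unit_rel_def quotient_def)
  then show ?thesis
    unfolding generating_set_def by (intro the_equality) blast+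
qed

section \<open>The general Laplacian and its contraction\<close>

definition laplacian ::
    "'a set \<Rightarrow> 'a set set \<Rightarrow> ('a \<Rightarrow> real) \<Rightarrow> ('a set \<Rightarrow> real) \<Rightarrow> ('a \<Rightarrow> complex) \<Rightarrow> 'a \<Rightarrow> complex" where
  "laplacian V E \<delta>V \<delta>E x v =
     (if v \<in> V
      then \<Sum>e\<in>star E v. of_real (\<delta>E e / \<delta>V v * (1 / real (card e) ^ 2)) * (\<Sum>u\<in>e. x v - x u)
      else 0)"

text \<open>
  \<open>c F\<close> is the constant value of the vertex weight on the unit with generating set \<open>F\<close>.
  In \<open>contraction_coeff\<close> the unit \<open>W\<close> is the row index (lower index \<open>j\<close> of \<open>c\<^sup>i\<^sub>j\<close>) and
  \<open>W'\<close> is the column index (upper index \<open>i\<close>).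
\<close>

definition contraction_coeff ::
    "'a set \<Rightarrow> 'a set set \<Rightarrow> ('a set set \<Rightarrow> real) \<Rightarrow> ('a set \<Rightarrow> real) \<Rightarrow> 'a set \<Rightarrow> 'a set \<Rightarrow> real" where
  "contraction_coeff V E c \<delta>E W W' =
     (\<Sum>e\<in>generating_set V E W.
        \<delta>E e / c (generating_set V E W) * (1 / real (card e) ^ 2) *
        ((if W' = W then 1 else 0) * real (card e) - real (card (e \<inter> W'))))"

definition contracted_laplacian ::
    "'a set \<Rightarrow> 'a set set \<Rightarrow> ('a set set \<Rightarrow> real) \<Rightarrow> ('a set \<Rightarrow> real)
      \<Rightarrow> ('a set \<Rightarrow> complex) \<Rightarrow> 'a set \<Rightarrow> complex" where
  "contracted_laplacian V E c \<delta>E y W =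
     (if W \<in> units V E
      then \<Sum>W'\<in>units V E. of_real (contraction_coeff V E c \<delta>E W W') * y W'
      else 0)"

definition blow_up :: "'a set \<Rightarrow> 'a set set \<Rightarrow> ('a set \<Rightarrow> complex) \<Rightarrow> 'a \<Rightarrow> complex" where
  "blow_up V E y v = (if v \<in> V then y (THE W. W \<in> units V E \<and> v \<in> W) else 0)"

definition sum_zero_space :: "'a set \<Rightarrow> 'a set \<Rightarrow> ('a \<Rightarrow> complex) set" where
  "sum_zero_space V U = {x \<in> cfun_space V. {v \<in> V. x v \<noteq> 0} \<subseteq> U \<and> (\<Sum>v\<in>U. x v) = 0}"

definition unit_eigenvalue ::
    "('a set set \<Rightarrow> real) \<Rightarrow> ('a set \<Rightarrow> real) \<Rightarrow> 'a set set \<Rightarrow> real" where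
  "unit_eigenvalue c \<delta>E F = (\<Sum>e\<in>F. \<delta>E e / (c F * real (card e)))"

end

theory Submission
  imports Defs
begin

text \<open>
  Two vertices of one unit lie in exactly the same edges, so the entry of the Laplacian at a pair
  of vertices is governed by the units of the two vertices. With \<open>W\<^sub>v\<close> the unit of \<open>v\<close>, let
  \<open>d(W)\<close> be the eigenvalue that the theorem attaches to \<open>W\<close>, and let \<open>b(W, W')\<close> be the sum of
  \<open>\<delta>\<^sub>E(e) / (c\<^sub>W |e|\<^sup>2)\<close> over the edges that contain both units. Then (\<open>laplacian_eq\<close>)
  \<open>(L x)(v) = d(W\<^sub>v) x(v) - (\<Sum>u. b(W\<^sub>v, W\<^sub>u) x(u))\<close>.
  On a function supported on one unit with sum zero the second term vanishes; on a blow up it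
  collects \<open>|W'|\<close> equal summands per unit \<open>W'\<close> and becomes the corresponding term of the contraction
  (\<open>contracted_laplacian_eq\<close>). This gives the eigenspace and eigenvector claims.

  The spectrum counts algebraic multiplicities, so the two characteristic polynomials are compared
  directly, which avoids diagonalising either operator. Let \<open>P\<close> be the vertex-unit incidence matrix, let \<open>X\<close>
  and \<open>Y\<close> be the diagonal matrices with entries \<open>t - d(W)\<close> indexed by vertices and by units, and let
  \<open>R = b P\<^sup>T\<close>. The characteristic matrices of the Laplacian and the contraction
  are \<open>X + P R\<close> and \<open>Y + R P\<close>, because \<open>P\<^sup>T P\<close> is the diagonal matrix of unit sizes. As \<open>d\<close> is
  constant on units, \<open>X P = P Y\<close>, and the Sylvester-type identity \<open>det_intertwining\<close> yields
  \<open>det (X + P R) det Y = det X det (Y + R P)\<close> over the polynomial ring. The roots of \<open>det X\<close> are the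
  \<open>d(W)\<close>, each \<open>|W|\<close> times, and those of \<open>det Y\<close> are the \<open>d(W)\<close>, each once, so cancelling
  leaves \<open>|W| - 1\<close> copies of each \<open>d(W)\<close> next to the spectrum of the contraction
  (\<open>op_spectrum_equitable\<close>).
\<close>

section \<open>Determinants along an intertwining matrix\<close>

text \<open>
  Both sides come from multiplying one block matrix on the right by a block triangular matrix. The
  first multiplier is the usual elimination of the lower left block. The second scales the last block
  column by \<open>Y\<close> and adds \<open>P\<close> times the first one, which clears the upper right block because
  \<open>X P = P Y\<close>; this takes the place of the inverse of \<open>X\<close> in the classical identity, so that the argument works over a
  polynomial ring.
\<close>

lemma det_intertwining:
  fixes X :: "'r :: idom mat"
  assumes X: "X \<in> carrier_mat n n" and Y: "Y \<in> carrier_mat m m"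
    and P: "P \<in> carrier_mat n m" and R: "R \<in> carrier_mat m n"
    and XP: "X * P = P * Y"
  shows "det (X + P * R) * det Y = det X * det (Y + R * P)"
proof -
  let ?N = "four_block_mat X (- P) R (1\<^sub>m m)"
  let ?A = "four_block_mat (1\<^sub>m n) (0\<^sub>m n m) (- R) (1\<^sub>m m)"
  let ?B = "four_block_mat (1\<^sub>m n) P (0\<^sub>m m n) Y"
  note carr = X Y P R
  have R_cancel: "R + - R = 0\<^sub>m m n"
    using carr by auto
  have N: "?N \<in> carrier_mat (n + m) (n + m)" and A: "?A \<in> carrier_mat (n + m) (n + m)"
    and B: "?B \<in> carrier_mat (n + m) (n + m)"
    using carr by auto
  have "?N * ?A = four_block_mat (X + P * R) (- P) (0\<^sub>m m n) (1\<^sub>m m)"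
    by (subst mult_four_block_mat[where ?nr1.0 = n and ?nr2.0 = m and ?n1.0 = n and ?n2.0 = m
          and ?nc1.0 = n and ?nc2.0 = m])
      (use carr in \<open>auto intro!: cong_four_block_mat simp: R_cancel\<close>)
  then have "det ?N * det ?A = det (X + P * R)"
    using det_mult[OF N A] det_four_block_mat_lower_left_zero[of "X + P * R" n "- P" m _ "1\<^sub>m m"] carr
    by simp
  moreover have "det ?A = 1"
    using det_four_block_mat_upper_right_zero[of "1\<^sub>m n" n _ m "- R" "1\<^sub>m m"] carr by simp
  moreover have "?N * ?B = four_block_mat X (0\<^sub>m n m) R (Y + R * P)"
    by (subst mult_four_block_mat[where ?nr1.0 = n and ?nr2.0 = m and ?n1.0 = n and ?n2.0 = m
          and ?nc1.0 = n and ?nc2.0 = m])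
      (use carr XP in \<open>auto intro!: cong_four_block_mat simp: comm_add_mat[of "R * P" m m Y]\<close>)
  then have "det ?N * det ?B = det X * det (Y + R * P)"
    using det_mult[OF N B] det_four_block_mat_upper_right_zero[of X n _ m R "Y + R * P"] carr
    by simp
  moreover have "det ?B = det Y"
    using det_four_block_mat_lower_left_zero[of "1\<^sub>m n" n P m _ Y] carr by simp
  ultimately show ?thesis by simp
qed

lemma bij_betw_nth_set:
  "distinct xs \<Longrightarrow> bij_betw ((!) xs) {0..<length xs} (set xs)"
  by (rule bij_betw_nth) auto

lemma det_diagonal_enum:
  fixes p :: "'a \<Rightarrow> 'r :: idom"
  assumes "distinct xs"
  shows "det (mat (length xs) (length xs) (\<lambda>(i, j). if i = j then p (xs ! i) else 0)) =
    (\<Prod>x\<in>set xs. p x)"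
proof -
  let ?D = "mat (length xs) (length xs) (\<lambda>(i, j). if i = j then p (xs ! i) else 0)"
  have "det ?D = prod_list (diag_mat ?D)"
    by (rule det_upper_triangular) auto
  also have "\<dots> = (\<Prod>i = 0..<length xs. p (xs ! i))"
    by (simp add: prod_list_diag_prod)
  also have "\<dots> = (\<Prod>x\<in>set xs. p x)"
    by (rule prod.reindex_bij_betw[OF bij_betw_nth_set[OF assms]])
  finally show ?thesis .
qed

section \<open>Spectra of operators constant on the blocks of a partition\<close>

lemma op_spectrum_enum:
  assumes "finite X"
  obtains xs where "distinct xs" "set xs = X"
    "op_spectrum X T = proots (char_poly (op_matrix xs T))"
proof -
  have "\<exists>xs. distinct xs \<and> set xs = X"
    using finite_distinct_list[OF assms] by blast
  from someI_ex[OF this] show thesis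
    by (auto intro!: that simp: op_spectrum_def)
qed

text \<open>
  Writing the operator as diagonal minus \<open>B\<close> makes the sign of \<open>B\<close> positive in the
  characteristic matrix, the form in which the determinant identity applies.
\<close>

lemma char_poly_matrix_op_matrix:
  assumes xs: "distinct xs" "set xs = X"
    and T: "\<And>x v. v \<in> X \<Longrightarrow> T x v = d v * x v - (\<Sum>u\<in>X. B v u * x u)"
  shows "char_poly_matrix (op_matrix xs T) = mat (length xs) (length xs)
    (\<lambda>(i, j). (if i = j then [:- d (xs ! i), 1:] else 0) + [:B (xs ! i) (xs ! j):])"
proof (rule eq_matI, goal_cases)
  case (1 i j)
  have fin: "finite X" using xs by auto
  have mem: "xs ! i \<in> X" "xs ! j \<in> X" using 1 xs by auto
  have eq: "xs ! i = xs ! j \<longleftrightarrow> i = j" using 1 xs by (simp add: nth_eq_iff_index_eq)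
  have "(\<Sum>u\<in>X. B (xs ! i) u * (if u = xs ! j then 1 else 0)) = B (xs ! i) (xs ! j)"
    using fin mem by (simp add: if_distrib cong: if_cong)
  then show ?case
    using 1 mem eq by (simp add: char_poly_matrix_def op_matrix_def T)
qed (auto simp: char_poly_matrix_def op_matrix_def)

text \<open>
  An operator whose matrix is constant on the blocks of a partition, up to a diagonal that is itself
  constant on blocks, against its quotient by the equitable partition. The incidence matrix \<open>P\<close> of
  points and blocks intertwines the two diagonals, and \<open>R\<close> is chosen so that the block-constant
  parts factor as \<open>P R\<close> on points and \<open>R P\<close> on blocks; the product \<open>R P\<close> counts the points
  of each block, which is where the sizes in the quotient come from.
\<close>

proposition op_spectrum_equitable:
  fixes blk :: "'a \<Rightarrow> 'b"
  assumes fin: "finite X" and U: "blk ` X = U"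
    and T: "\<And>x v. v \<in> X \<Longrightarrow> T x v = d (blk v) * x v - (\<Sum>u\<in>X. b (blk v) (blk u) * x u)"
    and S: "\<And>y k. k \<in> U \<Longrightarrow>
      S y k = d k * y k - (\<Sum>l\<in>U. of_nat (card {v \<in> X. blk v = l}) * b k l * y l)"
  shows "op_spectrum X T =
    (\<Sum>k\<in>U. replicate_mset (card {v \<in> X. blk v = k} - 1) (d k)) + op_spectrum U S"
proof -
  have finU: "finite U" using fin U by auto
  obtain xs where xs: "distinct xs" "set xs = X"
    "op_spectrum X T = proots (char_poly (op_matrix xs T))"
    using op_spectrum_enum[OF fin] .
  obtain ks where ks: "distinct ks" "set ks = U"
    "op_spectrum U S = proots (char_poly (op_matrix ks S))"
    using op_spectrum_enum[OF finU] .
  define n m where "n = length xs" and "m = length ks"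
  define q where "q k = [:- d k, 1:]" for k
  define D where "D = mat n n (\<lambda>(i, j). if i = j then q (blk (xs ! i)) else 0)"
  define Y where "Y = mat m m (\<lambda>(i, j). if i = j then q (ks ! i) else 0)"
  define P where "P = mat n m (\<lambda>(i, k). if blk (xs ! i) = ks ! k then 1 else 0 :: complex poly)"
  define R where "R = mat m n (\<lambda>(k, j). [:b (ks ! k) (blk (xs ! j)):])"
  have carr: "D \<in> carrier_mat n n" "Y \<in> carrier_mat m m" "P \<in> carrier_mat n m" "R \<in> carrier_mat m n"
    by (auto simp: D_def Y_def P_def R_def)
  have blk_mem: "blk (xs ! i) \<in> U" if "i < n" for i
    using that xs U by (auto simp: n_def)
  have sum_ks: "(\<Sum>k = 0..<m. f (ks ! k)) = (\<Sum>k\<in>U. f k)" for f :: "'b \<Rightarrow> complex poly"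
    using sum.reindex_bij_betw[OF bij_betw_nth_set[OF ks(1)]] ks(2) m_def by metis
  have sum_xs: "(\<Sum>i = 0..<n. f (xs ! i)) = (\<Sum>v\<in>X. f v)" for f :: "'a \<Rightarrow> complex poly"
    using sum.reindex_bij_betw[OF bij_betw_nth_set[OF xs(1)]] xs(2) n_def by metis
  have DP: "D * P = P * Y"
  proof (rule eq_matI, goal_cases)
    case (1 i k)
    then have ik: "i < n" "k < m" using carr by auto
    have "(D * P) $$ (i, k) = (\<Sum>j = 0..<n. (if i = j then q (blk (xs ! i)) else 0) *
        (if blk (xs ! j) = ks ! k then 1 else 0))"
      using ik by (auto simp: D_def P_def scalar_prod_def intro!: sum.cong)
    also have "\<dots> = (if blk (xs ! i) = ks ! k then q (ks ! k) else 0)"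
      using ik by (simp add: if_distrib[of "\<lambda>x. x * _"] cong: if_cong)
    also have "\<dots> = (\<Sum>l = 0..<m. (if blk (xs ! i) = ks ! l then 1 else 0) *
        (if l = k then q (ks ! l) else 0))"
      using ik by (simp add: if_distrib[of "\<lambda>x. _ * x"] cong: if_cong)
    also have "\<dots> = (P * Y) $$ (i, k)"
      using ik by (auto simp: Y_def P_def scalar_prod_def intro!: sum.cong)
    finally show ?case .
  qed (use carr in auto)
  have PR: "(P * R) $$ (i, j) = [:b (blk (xs ! i)) (blk (xs ! j)):]" if "i < n" "j < n" for i j
  proof -
    have "(P * R) $$ (i, j) =
        (\<Sum>k = 0..<m. (if blk (xs ! i) = ks ! k then 1 else 0) * [:b (ks ! k) (blk (xs ! j)):])"
      using that by (auto simp: P_def R_def scalar_prod_def intro!: sum.cong)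
    also have "\<dots> = (\<Sum>k\<in>U. (if blk (xs ! i) = k then 1 else 0) * [:b k (blk (xs ! j)):])"
      by (rule sum_ks[of "\<lambda>k. (if blk (xs ! i) = k then 1 else 0) * [:b k (blk (xs ! j)):]"])
    also have "\<dots> = [:b (blk (xs ! i)) (blk (xs ! j)):]"
      using finU blk_mem[OF that(1)]
      by (simp add: if_distrib[of "Polynomial.smult _"] one_pCons[symmetric] cong: if_cong)
    finally show ?thesis .
  qed
  have RP: "(R * P) $$ (k, l) = [:of_nat (card {v \<in> X. blk v = ks ! l}) * b (ks ! k) (ks ! l):]"
    if "k < m" "l < m" for k l
  proof -
    have "(R * P) $$ (k, l) =
        (\<Sum>i = 0..<n. [:b (ks ! k) (blk (xs ! i)):] * (if blk (xs ! i) = ks ! l then 1 else 0))"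
      using that by (auto simp: P_def R_def scalar_prod_def intro!: sum.cong)
    also have "\<dots> = (\<Sum>v\<in>X. [:b (ks ! k) (blk v):] * (if blk v = ks ! l then 1 else 0))"
      by (rule sum_xs[of "\<lambda>v. [:b (ks ! k) (blk v):] * (if blk v = ks ! l then 1 else 0)"])
    also have "\<dots> = (\<Sum>v\<in>{v \<in> X. blk v = ks ! l}. [:b (ks ! k) (ks ! l):])"
      using fin by (intro sum.mono_neutral_cong_right) auto
    also have "\<dots> = [:of_nat (card {v \<in> X. blk v = ks ! l}) * b (ks ! k) (ks ! l):]"
      by (simp add: of_nat_poly)
    finally show ?thesis .
  qed
  have "char_poly_matrix (op_matrix xs T) = D + P * R"
    by (subst char_poly_matrix_op_matrix[OF xs(1,2), where d = "\<lambda>v. d (blk v)"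
          and B = "\<lambda>v u. b (blk v) (blk u)"])
      (use carr in \<open>auto intro!: eq_matI simp: T PR simp del: index_mult_mat(1)
         simp: D_def q_def n_def\<close>)
  moreover have "char_poly_matrix (op_matrix ks S) = Y + R * P"
    by (subst char_poly_matrix_op_matrix[OF ks(1,2), where d = d
          and B = "\<lambda>k l. of_nat (card {v \<in> X. blk v = l}) * b k l"])
      (use carr in \<open>auto intro!: eq_matI simp: S RP simp del: index_mult_mat(1)
         simp: Y_def q_def m_def\<close>)
  \<comment> \<open>No division by \<open>det Y\<close>: the cancellation happens between multisets of roots.\<close>
  ultimately have key: "char_poly (op_matrix xs T) * det Y = det D * char_poly (op_matrix ks S)"
    using det_intertwining[OF carr DP] by (simp add: char_poly_def)
  have "det D = (\<Prod>v\<in>X. q (blk v))"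
    unfolding D_def n_def using det_diagonal_enum[OF xs(1), of "\<lambda>v. q (blk v)"] xs(2) by simp
  also have "\<dots> = (\<Prod>k\<in>U. q k ^ card {v \<in> X. blk v = k})"
    unfolding U[symmetric] by (subst prod.image_gen[OF fin, of _ blk]) simp
  finally have detD: "det D = (\<Prod>k\<in>U. q k ^ card {v \<in> X. blk v = k})" .
  have detY: "det Y = (\<Prod>k\<in>U. q k)"
    unfolding Y_def m_def using det_diagonal_enum[OF ks(1), of q] ks(2) by simp
  have q: "q k \<noteq> 0" "proots (q k) = {#d k#}" for k by (auto simp: q_def)
  have nz: "det D \<noteq> 0" "det Y \<noteq> 0" using finU q by (auto simp: detD detY)
  have nz': "char_poly (op_matrix xs T) \<noteq> 0" "char_poly (op_matrix ks S) \<noteq> 0"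
    using degree_monic_char_poly[of "op_matrix xs T" "length xs"]
      degree_monic_char_poly[of "op_matrix ks S" "length ks"]
    by (auto simp: op_matrix_def)
  have "op_spectrum X T + proots (det Y) = proots (det D) + op_spectrum U S"
    using arg_cong[OF key, of proots] nz nz' xs(3) ks(3) by (simp add: proots_mult)
  moreover have "proots (det Y) = (\<Sum>k\<in>U. {#d k#})"
    unfolding detY using q by (simp add: proots_prod)
  moreover have "proots (det D) =
      (\<Sum>k\<in>U. replicate_mset (card {v \<in> X. blk v = k} - 1) (d k)) + (\<Sum>k\<in>U. {#d k#})"
  proof -
    have "card {v \<in> X. blk v = k} = Suc (card {v \<in> X. blk v = k} - 1)" if "k \<in> U" for k
    proof -
      have "{v \<in> X. blk v = k} \<noteq> {}" using that U by auto
      then show ?thesis using fin by (simp add: card_gt_0_iff)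
    qed
    then have "replicate_mset (card {v \<in> X. blk v = k}) (d k) =
        replicate_mset (card {v \<in> X. blk v = k} - 1) (d k) + {#d k#}" if "k \<in> U" for k
      using that by (metis add_mset_add_single replicate_mset_Suc)
    then show ?thesis
      unfolding detD using q by (simp add: proots_prod proots_power sum.distrib[symmetric])
  qed
  ultimately show ?thesis by (simp add: ac_simps)
qed

section \<open>The Laplacian of a unit-weighted hypergraph\<close>

text \<open>
  Up to sign, the entry of the Laplacian at two distinct vertices with stars \<open>F\<close> and \<open>G\<close>.
\<close>

definition coupling ::
    "('a set set \<Rightarrow> real) \<Rightarrow> ('a set \<Rightarrow> real) \<Rightarrow> 'a set set \<Rightarrow> 'a set set \<Rightarrow> real" where
  "coupling c \<delta>E F G = (\<Sum>e\<in>F \<inter> G. \<delta>E e / c F * (1 / real (card e) ^ 2))"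

definition unit_of :: "'a set \<Rightarrow> 'a set set \<Rightarrow> 'a \<Rightarrow> 'a set" where
  "unit_of V E v = {u \<in> V. star E u = star E v}"

lemma units_eq: "units V E = unit_of V E ` V"
  by (auto simp: units_def quotient_def unit_rel_def unit_of_def)

lemma unit_of_self: "v \<in> V \<Longrightarrow> v \<in> unit_of V E v"
  by (simp add: unit_of_def)

lemma unit_of_in_units: "v \<in> V \<Longrightarrow> unit_of V E v \<in> units V E"
  by (simp add: units_eq)

lemma generating_set_unit_of: "v \<in> V \<Longrightarrow> generating_set V E (unit_of V E v) = star E v"
  by (rule generating_set_star[OF unit_of_in_units unit_of_self])

lemma unit_of_eqI: "W \<in> units V E \<Longrightarrow> v \<in> W \<Longrightarrow> unit_of V E v = W"
  by (auto simp: units_eq unit_of_def)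

lemma unit_subset: "W \<in> units V E \<Longrightarrow> W \<subseteq> V"
  by (auto simp: units_eq unit_of_def)

lemma unit_eq_fibre: "W \<in> units V E \<Longrightarrow> {v \<in> V. unit_of V E v = W} = W"
  by (auto dest: unit_subset unit_of_eqI simp: unit_of_self)

lemma blow_up_eq:
  assumes "v \<in> V"
  shows "blow_up V E y v = y (unit_of V E v)"
proof -
  have "(THE W. W \<in> units V E \<and> v \<in> W) = unit_of V E v"
    using assms by (auto intro!: the_equality simp: unit_of_in_units unit_of_self unit_of_eqI)
  then show ?thesis using assms by (simp add: blow_up_def)
qed

lemma vector_space_cscale: "vector_space cscale"
  by unfold_locales (auto simp: cscale_def algebra_simps)

lemma subspace_sum_zero_space: "module.subspace cscale (sum_zero_space V U)"
proof -
  interpret vector_space cscale by (rule vector_space_cscale)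
  have "sum_zero_space V U =
      {x. (\<forall>v. v \<notin> V \<longrightarrow> x v = 0) \<and> (\<forall>v\<in>V. v \<notin> U \<longrightarrow> x v = 0) \<and> (\<Sum>v\<in>U. x v) = 0}"
    by (auto simp: sum_zero_space_def cfun_space_def)
  then show ?thesis
    by (auto intro!: subspaceI simp: cscale_def sum.distrib sum_distrib_left[symmetric])
qed

text \<open>
  A weight constant on units is the same as a function \<open>c\<close> of the star, so the assumption can be
  stated pointwise.
\<close>

locale unit_weighted_hypergraph = hypergraph V E for V :: "'a set" and E :: "'a set set" +
  fixes \<delta>V :: "'a \<Rightarrow> real" and \<delta>E :: "'a set \<Rightarrow> real" and c :: "'a set set \<Rightarrow> real"
  assumes weight_star: "v \<in> V \<Longrightarrow> \<delta>V v = c (star E v)"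
begin

abbreviation gen where "gen \<equiv> generating_set V E"
abbreviation cls where "cls \<equiv> unit_of V E"
abbreviation unit_ev where "unit_ev W \<equiv> unit_eigenvalue c \<delta>E (gen W)"
abbreviation cpl where "cpl W W' \<equiv> coupling c \<delta>E (gen W) (gen W')"

lemma finite_edges: "finite E"
  using finite_vertices edge_subset by (meson Pow_iff finite_Pow_iff finite_subset subsetI)

lemma finite_star: "finite (star E v)"
  using finite_edges by (auto simp: star_def)

lemma finite_units: "finite (units V E)"
  using finite_vertices by (simp add: units_eq)

text \<open>
  The inner sum contributes \<open>|e| x(v)\<close>, which turns \<open>1 / |e|\<^sup>2\<close> into the \<open>1 / |e|\<close> of the unit
  eigenvalue; exchanging the sums over edges and vertices in the rest collects, for each \<open>u\<close>, the
  edges that contain both \<open>u\<close> and \<open>v\<close>.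
\<close>

lemma laplacian_eq:
  assumes v: "v \<in> V"
  shows "laplacian V E \<delta>V \<delta>E x v =
    of_real (unit_ev (cls v)) * x v - (\<Sum>u\<in>V. of_real (cpl (cls v) (cls u)) * x u)"
proof -
  define w where "w e = \<delta>E e / c (star E v) * (1 / real (card e) ^ 2)" for e
  have sumV: "(\<Sum>u\<in>e. x u) = (\<Sum>u\<in>V. if u \<in> e then x u else 0)" if "e \<in> star E v" for e
  proof -
    have "e \<subseteq> V" using that edge_subset by (auto simp: star_def)
    then show ?thesis using finite_vertices by (simp add: sum.If_cases Int_absorb1)
  qed
  have "laplacian V E \<delta>V \<delta>E x v =
      (\<Sum>e\<in>star E v. of_real (w e) * (\<Sum>u\<in>e. x v - x u))"
    using v by (simp add: laplacian_def w_def weight_star)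
  also have "\<dots> = (\<Sum>e\<in>star E v. of_real (w e * real (card e)) * x v -
      (\<Sum>u\<in>V. of_real (if u \<in> e then w e else 0) * x u))"
    by (intro sum.cong refl)
      (auto simp: sum_subtractf sumV right_diff_distrib sum_distrib_left mult.assoc intro!: sum.cong)
  also have "\<dots> = of_real (\<Sum>e\<in>star E v. w e * real (card e)) * x v -
      (\<Sum>u\<in>V. of_real (\<Sum>e\<in>star E v. if u \<in> e then w e else 0) * x u)"
    by (simp add: sum_subtractf sum_distrib_right sum.swap[of _ V] del: of_real_mult)
  also have "(\<Sum>e\<in>star E v. w e * real (card e)) = unit_ev (cls v)"
    unfolding unit_eigenvalue_def w_def using v
    by (intro sum.cong) (auto simp: generating_set_unit_of power2_eq_square)
  also have "(\<Sum>u\<in>V. of_real (\<Sum>e\<in>star E v. if u \<in> e then w e else 0) * x u) =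
      (\<Sum>u\<in>V. of_real (cpl (cls v) (cls u)) * x u)"
  proof (intro sum.cong refl)
    fix u assume u: "u \<in> V"
    have "star E v \<inter> {e. u \<in> e} = star E v \<inter> star E u" by (auto simp: star_def)
    then have "(\<Sum>e\<in>star E v. if u \<in> e then w e else 0) = cpl (cls v) (cls u)"
      using u v finite_star by (simp add: sum.If_cases coupling_def generating_set_unit_of w_def)
    then show "of_real (\<Sum>e\<in>star E v. if u \<in> e then w e else 0) * x u =
        of_real (cpl (cls v) (cls u)) * x u" by simp
  qed
  finally show ?thesis .
qed

text \<open>
  An edge that meets a unit contains it.
\<close>

lemma card_edge_Int_unit:
  assumes W: "W \<in> units V E" and e: "e \<in> E"
  shows "card (e \<inter> W) = (if e \<in> gen W then card W else 0)"
proof -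
  obtain u where u: "u \<in> V" and Wu: "W = cls u" using W by (auto simp: units_eq)
  have "e \<inter> W = (if e \<in> star E u then W else {})"
    using e by (auto simp: Wu unit_of_def star_def)
  then show ?thesis using u by (simp add: Wu generating_set_unit_of)
qed

lemma contraction_coeff_eq:
  assumes W: "W \<in> units V E" and W': "W' \<in> units V E"
  shows "contraction_coeff V E c \<delta>E W W' = (if W' = W then unit_ev W else 0) - real (card W') * cpl W W'"
proof -
  obtain v where v: "v \<in> V" and Wv: "W = cls v" using W by (auto simp: units_eq)
  define w where "w e = \<delta>E e / c (gen W) * (1 / real (card e) ^ 2)" for e
  have gen: "gen W = star E v" using v by (simp add: Wv generating_set_unit_of)
  have "contraction_coeff V E c \<delta>E W W' =
      (\<Sum>e\<in>gen W. (if W' = W then w e * real (card e) else 0) -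
        real (card W') * (if e \<in> gen W' then w e else 0))"
    unfolding contraction_coeff_def
    by (intro sum.cong refl)
      (auto simp: gen star_def card_edge_Int_unit[OF W'] w_def algebra_simps)
  also have "\<dots> = (if W' = W then (\<Sum>e\<in>gen W. w e * real (card e)) else 0) -
      real (card W') * (\<Sum>e\<in>gen W. if e \<in> gen W' then w e else 0)"
    by (simp add: sum_subtractf sum_distrib_left)
  also have "(\<Sum>e\<in>gen W. w e * real (card e)) = unit_ev W"
    unfolding unit_eigenvalue_def w_def by (intro sum.cong) (auto simp: power2_eq_square)
  also have "(\<Sum>e\<in>gen W. if e \<in> gen W' then w e else 0) = cpl W W'"
    unfolding coupling_def w_def[symmetric] by (rule sum.inter_restrict[symmetric]) (simp add: gen finite_star)
  finally show ?thesis .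
qed

lemma contracted_laplacian_eq:
  assumes W: "W \<in> units V E"
  shows "contracted_laplacian V E c \<delta>E y W = of_real (unit_ev W) * y W -
    (\<Sum>W'\<in>units V E. of_nat (card W') * of_real (cpl W W') * y W')"
proof -
  have "contracted_laplacian V E c \<delta>E y W =
      (\<Sum>W'\<in>units V E. (if W' = W then of_real (unit_ev W) * y W else 0) -
        of_nat (card W') * of_real (cpl W W') * y W')"
    using W by (auto simp: contracted_laplacian_def contraction_coeff_eq algebra_simps intro!: sum.cong)
  then show ?thesis using W finite_units by (simp add: sum_subtractf)
qed

lemma op_spectrum_laplacian:
  "op_spectrum V (laplacian V E \<delta>V \<delta>E) =
    (\<Sum>W\<in>units V E. replicate_mset (card W - 1) (of_real (unit_ev W))) +
    op_spectrum (units V E) (contracted_laplacian V E c \<delta>E)"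
proof -
  have "op_spectrum V (laplacian V E \<delta>V \<delta>E) =
      (\<Sum>W\<in>units V E. replicate_mset (card {v \<in> V. cls v = W} - 1) (of_real (unit_ev W))) +
      op_spectrum (units V E) (contracted_laplacian V E c \<delta>E)"
    by (rule op_spectrum_equitable[where b = "\<lambda>W W'. of_real (cpl W W')"])
      (simp_all add: finite_vertices units_eq[symmetric] laplacian_eq contracted_laplacian_eq
        unit_eq_fibre cong: sum.cong)
  then show ?thesis by (simp add: unit_eq_fibre cong: sum.cong)
qed

lemma sum_over_units: "(\<Sum>u\<in>V. f u) = (\<Sum>W\<in>units V E. \<Sum>u\<in>W. f u)" for f :: "'a \<Rightarrow> complex"
  using sum.image_gen[OF finite_vertices, of f cls]
  by (simp add: units_eq[symmetric] unit_eq_fibre cong: sum.cong)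

text \<open>
  The coupling is constant over the support of such a function, so it factors out of the sum over
  the unit, which is zero; only the diagonal term is left.
\<close>

lemma sum_zero_space_subset_eigenspace:
  assumes W: "W \<in> units V E"
  shows "sum_zero_space V W \<subseteq> op_eigenspace V (laplacian V E \<delta>V \<delta>E) (of_real (unit_ev W))"
proof
  fix x assume x: "x \<in> sum_zero_space V W"
  have "laplacian V E \<delta>V \<delta>E x v = of_real (unit_ev W) * x v" for v
  proof (cases "v \<in> V")
    case True
    have "(\<Sum>u\<in>V. of_real (cpl (cls v) (cls u)) * x u) =
        (\<Sum>u\<in>W. of_real (cpl (cls v) (cls u)) * x u)"
      using x unit_subset[OF W] finite_vertices
      by (intro sum.mono_neutral_right) (auto simp: sum_zero_space_def)
    also have "\<dots> = (\<Sum>u\<in>W. of_real (cpl (cls v) W) * x u)"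
      using W by (simp add: unit_of_eqI cong: sum.cong)
    also have "\<dots> = 0"
      using x by (simp add: sum_zero_space_def sum_distrib_left[symmetric])
    finally have "laplacian V E \<delta>V \<delta>E x v = of_real (unit_ev (cls v)) * x v"
      using True by (simp add: laplacian_eq)
    moreover have "x v = 0" if "cls v \<noteq> W"
      using x True that W by (auto simp: sum_zero_space_def dest: unit_of_eqI)
    ultimately show ?thesis by (cases "cls v = W") auto
  next
    case False
    then show ?thesis using x by (simp add: laplacian_def sum_zero_space_def cfun_space_def)
  qed
  then show "x \<in> op_eigenspace V (laplacian V E \<delta>V \<delta>E) (of_real (unit_ev W))"
    using x by (auto simp: op_eigenspace_def cscale_def sum_zero_space_def)
qed

text \<open>
  The difference of the indicators of two vertices of the unit is an eigenvector.
\<close>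

lemma op_eigenvalue_unit:
  assumes W: "W \<in> units V E" and card: "card W \<ge> 2"
  shows "op_eigenvalue V (laplacian V E \<delta>V \<delta>E) (of_real (unit_ev W))"
proof -
  obtain a b where ab: "a \<in> W" "b \<in> W" "a \<noteq> b"
    using card by (metis card_2_iff' obtain_subset_with_card_n subset_iff)
  define x :: "'a \<Rightarrow> complex" where "x v = (if v = a then 1 else 0) - (if v = b then 1 else 0)" for v
  have fin: "finite W" using unit_subset[OF W] finite_vertices finite_subset by blast
  have "x \<in> sum_zero_space V W"
    using ab fin unit_subset[OF W]
    by (auto simp: sum_zero_space_def cfun_space_def x_def sum_subtractf split: if_splits)
  moreover have "x a \<noteq> 0" using ab by (simp add: x_def)
  ultimately show ?thesis
    using sum_zero_space_subset_eigenspace[OF W] by (auto simp: op_eigenvalue_def op_eigenvector_def)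
qed

lemma laplacian_blow_up:
  assumes v: "v \<in> V"
  shows "laplacian V E \<delta>V \<delta>E (blow_up V E y) v = contracted_laplacian V E c \<delta>E y (cls v)"
proof -
  have "(\<Sum>u\<in>V. of_real (cpl (cls v) (cls u)) * blow_up V E y u) =
      (\<Sum>u\<in>V. of_real (cpl (cls v) (cls u)) * y (cls u))"
    by (simp add: blow_up_eq cong: sum.cong)
  also have "\<dots> = (\<Sum>W\<in>units V E. \<Sum>u\<in>W. of_real (cpl (cls v) W) * y W)"
    by (subst sum_over_units) (simp add: unit_of_eqI cong: sum.cong)
  finally show ?thesis
    using v by (simp add: laplacian_eq contracted_laplacian_eq unit_of_in_units blow_up_eq mult.assoc)
qed

lemma op_eigenvector_blow_up:
  assumes y: "op_eigenvector (units V E) (contracted_laplacian V E c \<delta>E) y \<mu>"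
  shows "op_eigenvector V (laplacian V E \<delta>V \<delta>E) (blow_up V E y) \<mu>"
proof -
  have supp: "y W = 0" if "W \<notin> units V E" for W
    using y that by (auto simp: op_eigenvector_def op_eigenspace_def cfun_space_def)
  have eig: "contracted_laplacian V E c \<delta>E y W = \<mu> * y W" for W
    using y by (auto simp: op_eigenvector_def op_eigenspace_def cscale_def)
  have "laplacian V E \<delta>V \<delta>E (blow_up V E y) v = \<mu> * blow_up V E y v" for v
    by (cases "v \<in> V") (simp_all add: laplacian_blow_up eig blow_up_eq, simp add: laplacian_def blow_up_def)
  then have "blow_up V E y \<in> op_eigenspace V (laplacian V E \<delta>V \<delta>E) \<mu>"
    by (auto simp: op_eigenspace_def cfun_space_def cscale_def blow_up_def)
  moreover have "blow_up V E y \<noteq> (\<lambda>_. 0)"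
  proof -
    obtain W where "y W \<noteq> 0" using y by (auto simp: op_eigenvector_def)
    moreover from this obtain v where "v \<in> V" "W = cls v" using supp by (auto simp: units_eq)
    ultimately have "blow_up V E y v \<noteq> 0" by (simp add: blow_up_eq)
    then show ?thesis by auto
  qed
  ultimately show ?thesis by (simp add: op_eigenvector_def)
qed

end

section \<open>The complete spectrum\<close>

theorem theorem3p7:
  fixes V :: "'a set" and E :: "'a set set"
    and \<delta>V :: "'a \<Rightarrow> real" and \<delta>E :: "'a set \<Rightarrow> real" and c :: "'a set set \<Rightarrow> real"
  assumes "hypergraph V E"
    and "\<forall>v\<in>V. \<delta>V v > 0"
    and "\<forall>e\<in>E. \<delta>E e > 0"
    and "\<forall>W\<in>units V E. \<forall>v\<in>W. \<delta>V v = c (generating_set V E W)"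
  shows
    "op_spectrum V (laplacian V E \<delta>V \<delta>E) =
       (\<Sum>W\<in>units V E. replicate_mset (card W - 1)
          (of_real (unit_eigenvalue c \<delta>E (generating_set V E W))))
       + op_spectrum (units V E) (contracted_laplacian V E c \<delta>E)
     \<and> (\<forall>W\<in>units V E.
          (card W \<ge> 2 \<longrightarrow>
             op_eigenvalue V (laplacian V E \<delta>V \<delta>E)
               (of_real (unit_eigenvalue c \<delta>E (generating_set V E W)))) \<and>
          module.subspace cscale (sum_zero_space V W) \<and>
          sum_zero_space V W \<subseteq>
            op_eigenspace V (laplacian V E \<delta>V \<delta>E)
              (of_real (unit_eigenvalue c \<delta>E (generating_set V E W))))
     \<and> (\<forall>\<mu> y. op_eigenvector (units V E) (contracted_laplacian V E c \<delta>E) y \<mu> \<longrightarrow>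
          op_eigenvector V (laplacian V E \<delta>V \<delta>E) (blow_up V E y) \<mu>)"
proof -
  interpret hypergraph V E by fact
  interpret unit_weighted_hypergraph V E \<delta>V \<delta>E c
  proof
    fix v assume "v \<in> V"
    then show "\<delta>V v = c (star E v)"
      using assms(4) unit_of_in_units[of v V E] unit_of_self[of v V E] generating_set_unit_of[of v V E]
      by metis
  qed
  show ?thesis
    using op_spectrum_laplacian op_eigenvalue_unit subspace_sum_zero_space
      sum_zero_space_subset_eigenspace op_eigenvector_blow_up
    by blast
qed

end
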